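(* Let $r,m\ge 1$. Consider the labeled chip-firing process on the line with $r$ copies of each edge, starting with $2rm$ chips with distinct labels from a totally ordered set, all at site $0$. In the final configuration (when no firing move is possible), for all chips $a$ and $b$ with $a<b$, the final position of $a$ is at or to the left of the final position of $b$, regardless of the choices of firing moves made.
   Context: The graph is $\mathbb{Z}$ with $r$ parallel edges between $i$ and $i+1$ for each integer $i$. A firing move consists of choosing $2r$ chips located at a common site $i$ and sending the $r$ chips with the smallest labels among them to site $i-1$ and the $r$ chips with the largest labels to site $i+1$. The process terminates when every site has fewer than $2r$ chips. *)

theory Defs
  imports Main
begin

text \<open>A configuration assigns to each chip (label) its site in the integers.
  Chips are the elements of a finite set L of labels from a linearly ordered type.\<close>

definition fire_move :: "'a::linorder set \<Rightarrow> nat \<Rightarrow> ('a \<Rightarrow> int) \<Rightarrow> ('a \<Rightarrow> int) \<Rightarrow> bool" where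
  "fire_move L r c c' \<longleftrightarrow>
     (\<exists>i S. S \<subseteq> {a \<in> L. c a = i} \<and> card S = 2 * r \<and>
        c' = (\<lambda>a. if a \<in> S then
                     (if card {b \<in> S. b < a} < r then i - 1 else i + 1)
                   else c a))"

definition terminal_config :: "'a::linorder set \<Rightarrow> nat \<Rightarrow> ('a \<Rightarrow> int) \<Rightarrow> bool" where
  "terminal_config L r c \<longleftrightarrow> (\<forall>i::int. card {a \<in> L. c a = i} < 2 * r)"

end

theory Submission
  imports Defs
begin

text \<open>All chip counts are multiples of \<open>r\<close>. Up to an added constant, the counts divided by \<open>r\<close>
  are second differences of a height function on the sites, which drops by one at a site
  whenever that site fires. Assign to each chip the height of its site. Where the height
  is at most \<open>m\<close>, and the site is not too far to the left, firing is rigid: the site holds exactly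
  \<open>2 * r\<close> chips, the half going right loses no height, and the half going left loses at most one,
  as in bubble sort. Among the largest \<open>r * j\<close> chips, one goes left only if \<open>r\<close> of them go right in
  the same move, so each level of height retains \<open>r\<close> of them. In the terminal configuration height
  and position agree on the right half of the line; the left half follows by reflection.\<close>

section \<open>Triangular numbers and the initial height function\<close>

definition tri :: "int \<Rightarrow> int" where
  "tri n = n * (n + 1) div 2"

lemma tri_add_one: "tri (n + 1) = tri n + n + 1"
proof -
  have "(n + 1) * (n + 1 + 1) = n * (n + 1) + 2 * (n + 1)"
    by (simp add: algebra_simps)
  then show ?thesis
    unfolding tri_def by simp
qed

lemma tri_zero [simp]: "tri 0 = 0"
  by (simp add: tri_def)

lemma tri_minus_one [simp]: "tri (- 1) = 0"
  by (simp add: tri_def)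

lemma tri_nonneg: "0 \<le> tri n"
proof -
  have "0 \<le> n * (n + 1)"
    by (auto simp: zero_le_mult_iff)
  then show ?thesis
    unfolding tri_def by simp
qed

lemma tri_ge: "n \<le> tri n"
proof (cases "1 \<le> n")
  case True
  then have "n * 2 \<le> n * (n + 1)"
    by (intro mult_left_mono) auto
  then show ?thesis
    unfolding tri_def by simp
next
  case False
  then show ?thesis
    using tri_nonneg[of n] by linarith
qed

definition init_height :: "int \<Rightarrow> int \<Rightarrow> int" where
  "init_height m i = tri (m - \<bar>i\<bar>) + max i 0"

text \<open>If site \<open>i\<close> has fired \<open>f i\<close> times, its height is \<open>init_height m i - f i\<close>. The first
  summand \<open>tri (m - \<bar>i\<bar>)\<close> is the eventual number of firings, and the summand \<open>max i 0\<close> makes the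
  chip count below uniform in \<open>i\<close>, without an exception at the origin.\<close>

definition chips :: "(int \<Rightarrow> int) \<Rightarrow> int \<Rightarrow> int" where
  "chips h i = 1 + 2 * h i - h (i - 1) - h (i + 1)"

lemma init_height_ge: "max i 0 \<le> init_height m i"
  using tri_nonneg[of "m - \<bar>i\<bar>"] by (simp add: init_height_def)

text \<open>\<open>tri\<close> has second difference one, and off the origin \<open>max i 0\<close>
  is linear, so the \<open>1\<close> in \<open>chips\<close> cancels. This persists for
  \<open>\<bar>i\<bar> > m + 1\<close>, where \<open>tri (m - \<bar>i\<bar>)\<close> is positive
  again and no longer counts firings.\<close>

lemma chips_init_height: "chips (init_height m) i = (if i = 0 then 2 * m else 0)"
proof -
  consider "i = 0" | "i > 0" | "i < 0" by linarith
  then show ?thesis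
  proof cases
    case 1
    then show ?thesis
      using tri_add_one[of "m - 1"] by (simp add: chips_def init_height_def)
  next
    case 2
    then have "\<bar>i\<bar> = i" "\<bar>i - 1\<bar> = i - 1" "\<bar>i + 1\<bar> = i + 1"
      by auto
    then show ?thesis
      using 2 tri_add_one[of "m - i - 1"] tri_add_one[of "m - i"]
      by (simp add: chips_def init_height_def algebra_simps)
  next
    case 3
    then have "\<bar>i\<bar> = - i" "\<bar>i - 1\<bar> = 1 - i" "\<bar>i + 1\<bar> = - i - 1"
      by auto
    then show ?thesis
      using 3 tri_add_one[of "m + i - 1"] tri_add_one[of "m + i"]
      by (simp add: chips_def init_height_def algebra_simps)
  qed
qed

section \<open>The unlabeled process: invariants of the height function\<close>

text \<open>The last condition says that a block \<open>[a, b]\<close> of sites which have all fired holds at least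
  \<open>b - a\<close> groups of \<open>r\<close> chips.\<close>

definition profile :: "int \<Rightarrow> (int \<Rightarrow> int) \<Rightarrow> bool" where
  "profile m h \<longleftrightarrow>
     (\<forall>i. max i 0 \<le> h i) \<and> (\<forall>i. h i \<le> init_height m i) \<and>
     (\<forall>i\<ge>0. h (i + 1) < init_height m (i + 1) \<longrightarrow> h i < init_height m i) \<and>
     (\<forall>i\<le>0. h (i - 1) < init_height m (i - 1) \<longrightarrow> h i < init_height m i) \<and>
     (\<forall>a b. a \<le> b \<longrightarrow> (\<forall>i\<in>{a..b}. h i < init_height m i) \<longrightarrow>
        h (b + 1) - h b \<le> h a - h (a - 1) + 1)"

lemma profile_init: "profile m (init_height m)"
  unfolding profile_def using init_height_ge
  by (metis atLeastAtMost_iff less_irrefl order_refl)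

context
  fixes m :: int and h :: "int \<Rightarrow> int"
  assumes h: "profile m h"
begin

lemma profile_lower: "max i 0 \<le> h i"
  using h by (simp add: profile_def)

lemma profile_upper: "h i \<le> init_height m i"
  using h by (simp add: profile_def)

lemma profile_fired_pred:
  "0 \<le> i \<Longrightarrow> h (i + 1) < init_height m (i + 1) \<Longrightarrow> h i < init_height m i"
  using h by (simp add: profile_def)

lemma profile_fired_succ:
  "i \<le> 0 \<Longrightarrow> h (i - 1) < init_height m (i - 1) \<Longrightarrow> h i < init_height m i"
  using h by (simp add: profile_def)

lemma profile_slope:
  assumes "a \<le> b" "\<And>i. a \<le> i \<Longrightarrow> i \<le> b \<Longrightarrow> h i < init_height m i"
  shows "h (b + 1) - h b \<le> h a - h (a - 1) + 1"
  using h assms by (simp add: profile_def)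

text \<open>The fired sites are closed under moving towards the origin. If \<open>x - 1\<close> had
  not fired, neither would \<open>x\<close> and \<open>x + 1\<close>, so \<open>x\<close> would
  still have its initial count zero.\<close>

lemma fired_left_of_firing:
  assumes "1 \<le> x" "2 \<le> chips h x"
  shows "h (x - 1) < init_height m (x - 1)"
proof (rule ccontr)
  assume "\<not> ?thesis"
  then have 1: "h (x - 1) = init_height m (x - 1)"
    using profile_upper[of "x - 1"] by simp
  then have 2: "h x = init_height m x"
    using profile_fired_pred[of "x - 1"] profile_upper[of x] assms(1) by fastforce
  then have 3: "h (x + 1) = init_height m (x + 1)"
    using profile_fired_pred[of x] profile_upper[of "x + 1"] assms(1) by fastforce
  have "chips h x = chips (init_height m) x"
    using 1 2 3 by (simp add: chips_def)
  then show False
    using assms chips_init_height[of m x] by simp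
qed

lemma fired_right_of_firing:
  assumes "x \<le> - 1" "2 \<le> chips h x"
  shows "h (x + 1) < init_height m (x + 1)"
proof (rule ccontr)
  assume "\<not> ?thesis"
  then have 1: "h (x + 1) = init_height m (x + 1)"
    using profile_upper[of "x + 1"] by simp
  then have 2: "h x = init_height m x"
    using profile_fired_succ[of "x + 1"] profile_upper[of x] assms(1) by fastforce
  then have 3: "h (x - 1) = init_height m (x - 1)"
    using profile_fired_succ[of x] profile_upper[of "x - 1"] assms(1) by fastforce
  have "chips h x = chips (init_height m) x"
    using 1 2 3 by (simp add: chips_def)
  then show False
    using assms chips_init_height[of m x] by simp
qed

text \<open>A descent to a height below \<open>m\<close> would persist up to site \<open>m\<close>, where the height is at least
  \<open>m\<close>: the slope at any later site exceeds it by at most one, and a site \<open>b > 0\<close> of height less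
  than \<open>m\<close> has fired.\<close>

lemma height_right:
  assumes "2 \<le> chips h x"
  shows "min (h x) m \<le> h (x + 1)"
proof (rule ccontr)
  assume "\<not> ?thesis"
  then have desc: "h (x + 1) < h x" "h (x + 1) < m"
    by auto
  then have le: "x + 1 \<le> m"
    using profile_lower[of "x + 1"] by linarith
  have fired: "h b < init_height m b" if "b > 0" "h b < m" for b
    using that tri_ge[of "m - b"] by (simp add: init_height_def)
  have start: "h (x + 1) < init_height m (x + 1)"
    using fired[of "x + 1"] fired_right_of_firing[OF _ assms] desc by linarith
  have "h b < m \<and> (\<forall>i. x + 1 \<le> i \<and> i \<le> b \<longrightarrow> h i < init_height m i)"
    if "x + 1 \<le> b" for b
    using that
  proof (induction b rule: int_ge_induct)
    case base
    have "i = x + 1" if "x + 1 \<le> i" "i \<le> x + 1" for i using that by simp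
    then show ?case using start desc by blast
  next
    case (step b)
    have "h (b + 1) - h b \<le> h (x + 1) - h (x + 1 - 1) + 1"
      using step by (intro profile_slope) auto
    then have lt: "h (b + 1) < m"
      using desc step by simp
    have "h (b + 1) < init_height m (b + 1)"
    proof (cases "b \<ge> 0")
      case True
      then show ?thesis using fired lt by simp
    next
      case False
      then show ?thesis
        using profile_fired_succ[of "b + 1"] step by simp
    qed
    moreover have "i \<le> b \<or> i = b + 1" if "i \<le> b + 1" for i using that by linarith
    ultimately show ?case
      using lt step by blast
  qed
  from this[OF le] show False
    using profile_lower[of m] by simp
qed

text \<open>Mirror image of \<open>height_right\<close>: reflection turns the height at
  \<open>y\<close> into \<open>h (- y) + y\<close>, which lowers the bound at the left neighbour by
  one and makes the cap depend on \<open>x\<close>.\<close>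

lemma height_left:
  assumes "2 \<le> chips h x"
  shows "min (h x - 1) (m + x - 1) \<le> h (x - 1)"
proof (rule ccontr)
  assume "\<not> ?thesis"
  then have desc: "h (x - 1) < h x - 1" "h (x - 1) < m + x - 1"
    by auto
  then have le: "- m \<le> x - 1"
    using profile_lower[of "x - 1"] by linarith
  have fired: "h b < init_height m b" if "b < 0" "h b < m + b" for b
    using that tri_ge[of "m + b"] by (simp add: init_height_def)
  have start: "h (x - 1) < init_height m (x - 1)"
    using fired[of "x - 1"] fired_left_of_firing[OF _ assms] desc by linarith
  have "h b < m + b \<and> (\<forall>i. b \<le> i \<and> i \<le> x - 1 \<longrightarrow> h i < init_height m i)"
    if "b \<le> x - 1" for b
    using that
  proof (induction b rule: int_le_induct)
    case base
    have "i = x - 1" if "x - 1 \<le> i" "i \<le> x - 1" for i using that by simp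
    moreover have "h (x - 1) < m + (x - 1)" using desc by simp
    ultimately show ?case using start by blast
  next
    case (step b)
    have "h (x - 1 + 1) - h (x - 1) \<le> h b - h (b - 1) + 1"
      using step by (intro profile_slope) auto
    then have lt: "h (b - 1) < m + (b - 1)"
      using desc step by simp
    have "h (b - 1) < init_height m (b - 1)"
    proof (cases "b \<le> 0")
      case True
      then show ?thesis using fired lt by simp
    next
      case False
      then show ?thesis
        using profile_fired_pred[of "b - 1"] step by simp
    qed
    moreover have "b \<le> i \<or> i = b - 1" if "b - 1 \<le> i" for i using that by linarith
    ultimately show ?case
      using lt step by blast
  qed
  from this[OF le] show False
    using profile_lower[of "- m"] by simp
qed

lemma profile_fire:
  assumes x: "2 \<le> chips h x"
  shows "profile m (h(x := h x - 1))"
  unfolding profile_def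
proof (intro conjI allI impI)
  fix i
  have "max x 0 < h x"
    using x profile_lower[of "x - 1"] profile_lower[of x] profile_lower[of "x + 1"]
    by (simp add: chips_def)
  then show "max i 0 \<le> (h(x := h x - 1)) i"
    using profile_lower[of i] by auto
  show "(h(x := h x - 1)) i \<le> init_height m i"
    using profile_upper[of i] by auto
next
  fix i :: int
  assume "0 \<le> i" "(h(x := h x - 1)) (i + 1) < init_height m (i + 1)"
  then show "(h(x := h x - 1)) i < init_height m i"
    using fired_left_of_firing[OF _ x] profile_fired_pred[of i] profile_upper[of x]
    by (cases "i + 1 = x"; cases "i = x") auto
next
  fix i :: int
  assume "i \<le> 0" "(h(x := h x - 1)) (i - 1) < init_height m (i - 1)"
  then show "(h(x := h x - 1)) i < init_height m i"
    using fired_right_of_firing[OF _ x] profile_fired_succ[of i] profile_upper[of x]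
    by (cases "i - 1 = x"; cases "i = x") auto
next
  fix a b :: int
  assume "a \<le> b" and "\<forall>i\<in>{a..b}. (h(x := h x - 1)) i < init_height m i"
  then have fired: "h i < init_height m i" if "a \<le> i" "i \<le> b" "i \<noteq> x" for i
    using that by (metis atLeastAtMost_iff fun_upd_other)
  have all: "h (b + 1) - h b \<le> h a - h (a - 1) + 1" if "x < a \<or> b < x"
    using that \<open>a \<le> b\<close> fired by (intro profile_slope) auto
  \<comment> \<open>Site \<open>x\<close> may be firing for the first time, so the slope condition
    is available only for the parts of the block on either side of \<open>x\<close>; the two groups
    of chips at \<open>x\<close> make up the difference.\<close>
  have lo: "h x - h (x - 1) \<le> h a - h (a - 1) + 1" if "a < x" "x \<le> b"
    using profile_slope[of a "x - 1"] that fired by auto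
  have hi: "h (b + 1) - h b \<le> h (x + 1) - h x + 1" if "a \<le> x" "x < b"
    using profile_slope[of "x + 1" b] that fired by auto
  consider "x < a - 1" | "x = a - 1" | "x = a" "a = b" | "x = a" "a < b" | "a < x" "x < b"
    | "a < x" "x = b" | "x = b + 1" | "x > b + 1"
    using \<open>a \<le> b\<close> by linarith
  then show "(h(x := h x - 1)) (b + 1) - (h(x := h x - 1)) b
      \<le> (h(x := h x - 1)) a - (h(x := h x - 1)) (a - 1) + 1"
    using all lo hi x \<open>a \<le> b\<close> by cases (auto simp: chips_def)
qed

text \<open>At most one group per site makes \<open>h\<close> convex. Its lower and upper bounds
  coincide at \<open>- m - 1\<close>, \<open>- m\<close>, \<open>m\<close> and \<open>m + 1\<close>,
  so the slopes run from 0 to 1. A positive \<open>h 0\<close> would force a positive value at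
  \<open>- m\<close> or a value above \<open>m\<close> at \<open>m\<close>.\<close>

lemma profile_terminal:
  assumes m: "0 \<le> m" and terminal: "\<And>i. chips h i \<le> 1" and i: "- m \<le> i" "i \<le> m"
  shows "h i = max i 0"
proof -
  have conv: "h (a + 1) - h a \<le> h (b + 1) - h b" if "a \<le> b" for a b
    using that
  proof (induction b rule: int_ge_induct)
    case (step b)
    then show ?case using terminal[of "b + 1"] by (simp add: chips_def)
  qed simp
  have ends: "h m = m" "h (m + 1) = m + 1" "h (- m) = 0" "h (- m - 1) = 0"
    using m profile_lower[of m] profile_upper[of m] profile_lower[of "m + 1"]
      profile_upper[of "m + 1"] profile_lower[of "- m"] profile_upper[of "- m"]
      profile_lower[of "- m - 1"] profile_upper[of "- m - 1"]
    by (auto simp: init_height_def)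
  have up: "h (b + 1) \<le> h b + 1" if "b \<le> m" for b
    using conv[OF that] ends by simp
  have mono: "h b \<le> h (b + 1)" if "- m - 1 \<le> b" for b
    using conv[OF that] ends by simp
  have "h 0 = 0"
  proof (rule ccontr)
    assume "h 0 \<noteq> 0"
    then have pos: "0 < h 0"
      using profile_lower[of 0] by simp
    have slope: "1 \<le> h (0 + 1) - h 0"
    proof (rule ccontr)
      assume *: "\<not> ?thesis"
      have "h 0 \<le> h b" if "b \<le> 0" for b
        using that
      proof (induction b rule: int_le_induct)
        case (step b)
        then show ?case using conv[of "b - 1" 0] * by simp
      qed simp
      from this[of "- m"] show False
        using m ends pos by simp
    qed
    have "h 0 + b \<le> h b" if "0 \<le> b" for b
      using that
    proof (induction b rule: int_ge_induct)
      case (step b)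
      then show ?case using conv[of 0 b] slope by simp
    qed simp
    from this[OF m] show False
      using ends pos by simp
  qed
  have "h b \<le> b" if "0 \<le> b" "b \<le> m" for b
    using that
  proof (induction b rule: int_ge_induct)
    case (step b)
    then show ?case using up[of b] by simp
  qed (simp add: \<open>h 0 = 0\<close>)
  moreover have "b \<ge> - m \<Longrightarrow> h b \<le> 0" if "b \<le> 0" for b
    using that
  proof (induction b rule: int_le_induct)
    case (step b)
    then show ?case using mono[of "b - 1"] by simp
  qed (simp add: \<open>h 0 = 0\<close>)
  ultimately show ?thesis
    using profile_lower[of i] i by (cases "0 \<le> i") (simp_all add: order_antisym)
qed

end

section \<open>Labeled chips: bounds level by level\<close>

text \<open>All that the argument needs to know about labels: a chip of \<open>U\<close> is sent to the left only if
  all chips sent to the right belong to \<open>U\<close>. Large chips satisfy this, and so do small chips in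
  the reflected process.\<close>

definition split_move :: "'a set \<Rightarrow> nat \<Rightarrow> 'a set \<Rightarrow> ('a \<Rightarrow> int) \<Rightarrow> ('a \<Rightarrow> int) \<Rightarrow> bool" where
  "split_move L r U c c' \<longleftrightarrow>
     (\<exists>x A B. A \<union> B \<subseteq> {a \<in> L. c a = x} \<and> A \<inter> B = {} \<and> card A = r \<and> card B = r \<and>
        (A \<inter> U \<noteq> {} \<longrightarrow> B \<subseteq> U) \<and>
        c' = (\<lambda>a. if a \<in> A then x - 1 else if a \<in> B then x + 1 else c a))"

text \<open>A chip of \<open>U\<close> enters \<open>unsorted \<dots> t\<close> only by a left move from a site contained in
  \<open>unsorted \<dots> (t + 1)\<close>, and that site then also holds \<open>r\<close> chips of \<open>U\<close> going right. This
  carries the bound in \<open>split_inv\<close> from \<open>t + 1\<close> to \<open>t\<close>. The sites left of \<open>t - m\<close> are included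
  because firing is not rigid there, whatever their height.\<close>

definition unsorted :: "int \<Rightarrow> (int \<Rightarrow> int) \<Rightarrow> 'a set \<Rightarrow> ('a \<Rightarrow> int) \<Rightarrow> int \<Rightarrow> 'a set" where
  "unsorted m h U c t = {a \<in> U. c a \<le> t - m - 1 \<or> h (c a) < t}"

text \<open>If \<open>U\<close> has \<open>r * j\<close> chips, the bound is no restriction at
  \<open>t = m + 1\<close>, and each level below allows \<open>r\<close> chips fewer, until none is
  allowed from \<open>t = m - j + 1\<close> downwards.\<close>

definition split_inv ::
  "'a set \<Rightarrow> nat \<Rightarrow> int \<Rightarrow> int \<Rightarrow> 'a set \<Rightarrow> ('a \<Rightarrow> int) \<Rightarrow> (int \<Rightarrow> int) \<Rightarrow> bool" where
  "split_inv L r m j U c h \<longleftrightarrow> profile m h \<and>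
     (\<forall>i. int (card {a \<in> L. c a = i}) = int r * chips h i) \<and>
     (\<forall>t \<le> m + 1. int (card (unsorted m h U c t)) \<le> int r * max 0 (j + t - m - 1))"

lemma split_inv_init:
  assumes L: "finite L" "int (card L) = 2 * int r * m" and m: "0 \<le> m"
    and U: "U \<subseteq> L" "int (card U) = int r * j"
  shows "split_inv L r m j U (\<lambda>_. 0) (init_height m)"
  unfolding split_inv_def
proof (intro conjI allI impI)
  show "profile m (init_height m)"
    by (rule profile_init)
next
  fix i
  show "int (card {a \<in> L. 0 = i}) = int r * chips (init_height m) i"
    using L by (simp add: chips_init_height)
next
  fix t assume t: "t \<le> m + 1"
  show "int (card (unsorted m (init_height m) U (\<lambda>_. 0) t)) \<le> int r * max 0 (j + t - m - 1)"
  proof (cases "t = m + 1")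
    case True
    have "card (unsorted m (init_height m) U (\<lambda>_. 0) t) \<le> card U"
      using L U by (intro card_mono) (auto simp: unsorted_def intro: finite_subset)
    also have "int (card U) \<le> int r * max 0 j"
      unfolding U by (intro mult_left_mono) auto
    finally show ?thesis using True by simp
  next
    case False
    then have "unsorted m (init_height m) U (\<lambda>_. 0) t = {}"
      using t m tri_ge[of m] by (auto simp: unsorted_def init_height_def)
    then show ?thesis by simp
  qed
qed

lemma card_shift:
  fixes c :: "'a \<Rightarrow> int"
  assumes L: "finite L" and AB: "A \<union> B \<subseteq> {a \<in> L. c a = x}" "A \<inter> B = {}" "card A = r" "card B = r"
    and c': "c' = (\<lambda>a. if a \<in> A then x - 1 else if a \<in> B then x + 1 else c a)"
  shows "int (card {a \<in> L. c' a = i}) = int (card {a \<in> L. c a = i})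
    + (if i = x then - 2 * int r else if i = x - 1 \<or> i = x + 1 then int r else 0)"
proof -
  have fin: "finite A" "finite B"
    using AB(1) L by (auto intro: finite_subset)
  have AL: "A \<subseteq> L" "B \<subseteq> L" "\<And>a. a \<in> A \<Longrightarrow> c a = x" "\<And>a. a \<in> B \<Longrightarrow> c a = x"
    using AB(1) by auto
  consider "i = x" | "i = x - 1" | "i = x + 1" | "i \<noteq> x" "i \<noteq> x - 1" "i \<noteq> x + 1" by blast
  then show ?thesis
  proof cases
    case 1
    have "{a \<in> L. c a = i} = {a \<in> L. c' a = i} \<union> (A \<union> B)"
      using 1 AL by (auto simp: c')
    moreover have "{a \<in> L. c' a = i} \<inter> (A \<union> B) = {}"
      using 1 by (auto simp: c')
    ultimately have "card {a \<in> L. c a = i} = card {a \<in> L. c' a = i} + (card A + card B)"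
      using L fin AB(2) by (simp add: card_Un_disjoint)
    then show ?thesis using 1 AB by simp
  next
    case 2
    have "{a \<in> L. c' a = i} = {a \<in> L. c a = i} \<union> A" "{a \<in> L. c a = i} \<inter> A = {}"
      using 2 AL by (auto simp: c')
    then have "card {a \<in> L. c' a = i} = card {a \<in> L. c a = i} + card A"
      using L fin by (simp add: card_Un_disjoint)
    then show ?thesis using 2 AB by simp
  next
    case 3
    have "{a \<in> L. c' a = i} = {a \<in> L. c a = i} \<union> B" "{a \<in> L. c a = i} \<inter> B = {}"
      using 3 AL AB(2) by (auto simp: c')
    then have "card {a \<in> L. c' a = i} = card {a \<in> L. c a = i} + card B"
      using L fin by (simp add: card_Un_disjoint)
    then show ?thesis using 3 AB by simp
  next
    case 4
    have "{a \<in> L. c' a = i} = {a \<in> L. c a = i}"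
      using 4 AL by (auto simp: c')
    then show ?thesis using 4 by simp
  qed
qed

lemma split_inv_step:
  assumes L: "finite L" and r: "1 \<le> r" and U: "U \<subseteq> L" "int (card U) = int r * j"
    and inv: "split_inv L r m j U c h" and move: "split_move L r U c c'"
  shows "\<exists>h'. split_inv L r m j U c' h'"
proof -
  obtain x A B where AB: "A \<union> B \<subseteq> {a \<in> L. c a = x}" "A \<inter> B = {}" "card A = r" "card B = r"
    and AU: "A \<inter> U \<noteq> {} \<longrightarrow> B \<subseteq> U"
    and c': "c' = (\<lambda>a. if a \<in> A then x - 1 else if a \<in> B then x + 1 else c a)"
    using move unfolding split_move_def by blast
  define h' where "h' = h(x := h x - 1)"
  have prof: "profile m h"
    and cnt: "\<And>i. int (card {a \<in> L. c a = i}) = int r * chips h i"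
    and bnd: "\<And>t. t \<le> m + 1 \<Longrightarrow>
      int (card (unsorted m h U c t)) \<le> int r * max 0 (j + t - m - 1)"
    using inv by (auto simp: split_inv_def)
  have fin: "finite U" "finite A" "finite B" "finite {a \<in> L. c a = x}"
    using L U AB(1) by (auto intro: finite_subset)
  have at_x: "\<And>a. a \<in> A \<Longrightarrow> c a = x" "\<And>a. a \<in> B \<Longrightarrow> c a = x"
    using AB(1) by auto
  have cardAB: "card (A \<union> B) = 2 * r"
    using fin AB by (simp add: card_Un_disjoint)
  then have "2 * r \<le> card {a \<in> L. c a = x}"
    using card_mono[OF fin(4) AB(1)] by simp
  then have "int r * 2 \<le> int r * chips h x"
    using cnt[of x] by linarith
  then have x: "2 \<le> chips h x"
    using r by simp
  have "int (card {a \<in> L. c' a = i}) = int r * chips h' i" for i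
    unfolding card_shift[OF L AB c'] cnt
    by (auto simp: chips_def h'_def algebra_simps)
  moreover have "int (card (unsorted m h' U c' t)) \<le> int r * max 0 (j + t - m - 1)"
    if t: "t \<le> m + 1" for t
  proof -
    let ?R = "unsorted m h U c" and ?R' = "unsorted m h' U c' t"
    have finR: "finite (?R s)" for s
      using fin(1) by (simp add: unsorted_def)
    have whole: "int (card ?R') \<le> int r * max 0 j"
    proof -
      have "card ?R' \<le> card U"
        using fin(1) by (intro card_mono) (auto simp: unsorted_def)
      also have "int (card U) \<le> int r * max 0 j"
        unfolding U by (intro mult_left_mono) auto
      finally show ?thesis by simp
    qed
    have sub: ?thesis if "?R' \<subseteq> ?R t"
      using card_mono[OF finR that] bnd[OF t] by linarith
    have other: "a \<in> ?R t" if "a \<in> ?R'" "c a \<noteq> x" for a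
    proof -
      have "c' a = c a"
        using that at_x unfolding c' by auto
      then show ?thesis
        using that by (simp add: unsorted_def h'_def)
    qed
    consider "t = m + 1" | "t \<le> m" "x \<le> t - m - 1 \<or> h x < t"
      | "t \<le> m" "t - m - 1 < x" "t \<le> h x"
      using t by linarith
    then show ?thesis
    proof cases
      case 1
      then show ?thesis using whole by simp
    next
      case 2
      then have "?R' \<subseteq> ?R t"
        using other by (auto simp: unsorted_def)
      then show ?thesis by (rule sub)
    next
      case 3
      have right: "t \<le> h (x + 1)"
        using height_right[OF prof x] 3 by linarith
      have stay: "a \<in> A \<union> B" if "a \<in> ?R'" "c a = x" for a
      proof (rule ccontr)
        assume a: "a \<notin> A \<union> B"
        then have "h x = t"
          using that 3 by (auto simp: unsorted_def c' h'_def)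
        \<comment> \<open>Rigidity: neither neighbour is too low, so a site dropping below
          \<open>t\<close> holds exactly \<open>2 * r\<close> chips and none stays behind.\<close>
        then have "chips h x \<le> 2"
          using right height_left[OF prof x] 3 by (simp add: chips_def)
        then have "int r * chips h x \<le> int r * 2"
          by (intro mult_left_mono) auto
        then have "card {a \<in> L. c a = x} \<le> card (A \<union> B)"
          using cnt[of x] cardAB by linarith
        then have "A \<union> B = {a \<in> L. c a = x}"
          using AB(1) fin(4) by (intro card_seteq) auto
        then show False
          using a that U by (auto simp: unsorted_def)
      qed
      have "a \<notin> ?R'" if "a \<in> B" for a
        using that AB(2) right 3 by (auto simp: unsorted_def c' h'_def)
      then have R': "?R' \<subseteq> ?R t \<union> (A \<inter> U)"
        using other stay by (auto simp: unsorted_def)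
      show ?thesis
      proof (cases "A \<inter> U = {} \<or> (t + 1 \<le> h x \<and> t - m < x)")
        case True
        \<comment> \<open>In the strict case the left neighbour also has height at least
          \<open>t\<close>, so the chips going left do not enter level \<open>t\<close>.\<close>
        have "a \<notin> ?R'" if "a \<in> A" "A \<inter> U \<noteq> {}" for a
          using that height_left[OF prof x] True by (auto simp: unsorted_def c' h'_def)
        then have "?R' \<subseteq> ?R t"
          using R' by blast
        then show ?thesis by (rule sub)
      next
        case False
        then have "B \<subseteq> U"
          using AU by blast
        \<comment> \<open>Now \<open>h x = t\<close> or \<open>x = t - m\<close>, so the chips of
          \<open>U\<close> at \<open>x\<close> are counted at level \<open>t + 1\<close> but not at
          \<open>t\<close>. The \<open>r\<close> chips of \<open>B\<close> pay for the difference of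
          the two bounds.\<close>
        have "?R t \<union> ((A \<inter> U) \<union> B) \<subseteq> ?R (t + 1)"
          using False 3 \<open>B \<subseteq> U\<close> at_x by (auto simp: unsorted_def)
        then have "card (?R t \<union> ((A \<inter> U) \<union> B)) \<le> card (?R (t + 1))"
          by (intro card_mono finR)
        moreover have "?R t \<inter> ((A \<inter> U) \<union> B) = {}"
          using 3 at_x by (auto simp: unsorted_def)
        moreover have "card ((A \<inter> U) \<union> B) = card (A \<inter> U) + r"
          using fin AB by (subst card_Un_disjoint) auto
        ultimately have "card (?R t) + (card (A \<inter> U) + r) \<le> card (?R (t + 1))"
          using fin finR by (simp add: card_Un_disjoint)
        moreover have "card ?R' \<le> card (?R t) + card (A \<inter> U)"
          using card_mono[OF _ R'] card_Un_le[of "?R t" "A \<inter> U"] finR fin by fastforce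
        moreover have "int (card (?R (t + 1))) \<le> int r * max 0 (j + t - m)"
          using bnd[of "t + 1"] 3 by (simp add: algebra_simps)
        ultimately have le: "int (card ?R') + int r \<le> int r * max 0 (j + t - m)"
          by linarith
        \<comment> \<open>The left side is at least \<open>r\<close>, so the maximum is not the
          default \<open>0\<close>, and subtracting \<open>r\<close> gives the bound for
          \<open>t\<close>.\<close>
        then have "0 < j + t - m"
          using r by (cases "0 < j + t - m") auto
        then show ?thesis
          using le by (simp add: algebra_simps)
      qed
    qed
  qed
  ultimately have "split_inv L r m j U c' h'"
    using profile_fire[OF prof x] by (auto simp: split_inv_def h'_def)
  then show ?thesis by blast
qed

lemma split_inv_reachable:
  assumes "finite L" "1 \<le> r" "int (card L) = 2 * int r * m" "0 \<le> m"
    and "U \<subseteq> L" "int (card U) = int r * j"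
    and "(split_move L r U)\<^sup>*\<^sup>* (\<lambda>_. 0) c"
  shows "\<exists>h. split_inv L r m j U c h"
  using assms(7)
proof (induction rule: rtranclp_induct)
  case base
  then show ?case using split_inv_init assms by blast
next
  case (step c c')
  then show ?case using split_inv_step assms by blast
qed

lemma split_terminal:
  assumes L: "finite L" and r: "1 \<le> r" and cL: "int (card L) = 2 * int r * m" and m: "0 \<le> m"
    and U: "U \<subseteq> L" "int (card U) = int r * j"
    and reach: "(split_move L r U)\<^sup>*\<^sup>* (\<lambda>_. 0) c" and terminal: "terminal_config L r c"
  shows split_terminal_count:
      "1 \<le> \<bar>i\<bar> \<Longrightarrow> \<bar>i\<bar> \<le> m \<Longrightarrow> card {a \<in> L. c a = i} = r"
    and split_terminal_ge: "j \<le> m \<Longrightarrow> a \<in> U \<Longrightarrow> m - j + 1 \<le> c a"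
proof -
  obtain h where prof: "profile m h"
    and cnt: "\<And>i. int (card {a \<in> L. c a = i}) = int r * chips h i"
    and bnd: "\<And>t. t \<le> m + 1 \<Longrightarrow>
      int (card (unsorted m h U c t)) \<le> int r * max 0 (j + t - m - 1)"
    using split_inv_reachable[OF L r cL m U reach] by (auto simp: split_inv_def)
  have le: "chips h i \<le> 1" for i
  proof -
    have "card {a \<in> L. c a = i} < 2 * r"
      using terminal by (simp add: terminal_config_def)
    then have "int r * chips h i < int r * 2"
      using cnt[of i] by linarith
    then show ?thesis
      using r by simp
  qed
  note h = profile_terminal[OF prof m le]
  have ends: "h (m + 1) = m + 1" "h (- m - 1) = 0"
    using m profile_lower[OF prof, of "m + 1"] profile_upper[OF prof, of "m + 1"]
      profile_lower[OF prof, of "- m - 1"] profile_upper[OF prof, of "- m - 1"]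
    by (auto simp: init_height_def)
  \<comment> \<open>The counts at \<open>m\<close> and \<open>- m\<close> involve one further site
    on each side.\<close>
  have h': "h i = max i 0" if "- m - 1 \<le> i" "i \<le> m + 1" for i
    using that h[of i] ends m by (cases "i = m + 1"; cases "i = - m - 1") auto
  show "card {a \<in> L. c a = i} = r" if "1 \<le> \<bar>i\<bar>" "\<bar>i\<bar> \<le> m"
  proof -
    have "chips h i = 1"
      using that by (auto simp: chips_def h')
    then show ?thesis using cnt[of i] by simp
  qed
  show "m - j + 1 \<le> c a" if "j \<le> m" "a \<in> U"
  proof (rule ccontr)
    assume a: "\<not> ?thesis"
    have "0 \<le> int r * j"
      by (simp flip: U(2))
    then have j: "0 \<le> j"
      using r by (simp add: zero_le_mult_iff)
    \<comment> \<open>At level \<open>m - j + 1\<close> the bound vanishes. As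
      \<open>j \<le> m\<close>, this level is positive, so a chip of that height is right of the
      origin, where height equals position up to \<open>m\<close>.\<close>
    have "card (unsorted m h U c (m - j + 1)) = 0"
      using bnd[of "m - j + 1"] j by simp
    moreover have "finite (unsorted m h U c (m - j + 1))"
      using U L by (auto simp: unsorted_def intro: finite_subset)
    ultimately have "a \<notin> unsorted m h U c (m - j + 1)"
      by simp
    then have "- j < c a" "m - j + 1 \<le> h (c a)"
      using \<open>a \<in> U\<close> by (auto simp: unsorted_def)
    moreover from this have "h (c a) = max (c a) 0"
      using a j \<open>j \<le> m\<close> by (intro h) auto
    ultimately show False
      using a \<open>j \<le> m\<close> by linarith
  qed
qed

section \<open>Ranks of labels, and firing moves as split moves\<close>

lemma bij_betw_rank:
  fixes S :: "'a::linorder set"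
  assumes "finite S"
  shows "bij_betw (\<lambda>a. card {b \<in> S. b < a}) S {..<card S}"
proof -
  have less: "card {b \<in> S. b < a} < card {b \<in> S. b < a'}" if "a \<in> S" "a < a'" for a a'
    using assms that by (intro psubset_card_mono) auto
  have inj: "inj_on (\<lambda>a. card {b \<in> S. b < a}) S"
    by (rule linorder_inj_onI) (use less in fastforce)+
  then have "card ((\<lambda>a. card {b \<in> S. b < a}) ` S) = card S"
    by (rule card_image)
  moreover have "(\<lambda>a. card {b \<in> S. b < a}) ` S \<subseteq> {..<card S}"
    using assms by (auto intro!: psubset_card_mono)
  ultimately have "(\<lambda>a. card {b \<in> S. b < a}) ` S = {..<card S}"
    by (intro card_subset_eq) simp_all
  with inj show ?thesis
    by (simp add: bij_betw_def)
qed

lemma card_rank_less: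
  fixes S :: "'a::linorder set"
  assumes "finite S" "k \<le> card S"
  shows "card {a \<in> S. card {b \<in> S. b < a} < k} = k"
proof -
  define f where "f a = card {b \<in> S. b < a}" for a
  have bij: "bij_betw f S {..<card S}"
    using bij_betw_rank[OF assms(1)] by (simp add: f_def[abs_def])
  have "f ` {a \<in> S. f a < k} = f ` S \<inter> {..<k}"
    by auto
  also have "\<dots> = {..<k}"
    using bij assms(2) by (auto simp: bij_betw_def)
  finally have "card (f ` {a \<in> S. f a < k}) = k"
    by simp
  moreover have "inj_on f {a \<in> S. f a < k}"
    using bij by (auto simp: bij_betw_def intro: inj_on_subset)
  ultimately have "card {a \<in> S. f a < k} = k"
    by (simp add: card_image)
  then show ?thesis
    by (simp add: f_def)
qed

lemma rank_mono:
  fixes S :: "'a::linorder set"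
  assumes "finite S" "a \<le> a'"
  shows "card {b \<in> S. b < a} \<le> card {b \<in> S. b < a'}"
  using assms by (intro card_mono) auto

text \<open>Every label in the lower half \<open>A\<close> is below every label in the upper half
  \<open>B\<close>, so an upward closed \<open>U\<close> meeting \<open>A\<close> contains
  \<open>B\<close>. Negating positions exchanges the halves, which gives the downward closed
  version.\<close>

lemma fire_move_split:
  fixes L :: "'a::linorder set"
  assumes L: "finite L" and r: "1 \<le> r" and move: "fire_move L r c c'"
  shows fire_move_split_up:
      "(\<And>a b. a \<in> U \<Longrightarrow> b \<in> L \<Longrightarrow> a < b \<Longrightarrow> b \<in> U) \<Longrightarrow> split_move L r U c c'"
    and fire_move_split_down:
      "(\<And>a b. a \<in> D \<Longrightarrow> b \<in> L \<Longrightarrow> b < a \<Longrightarrow> b \<in> D) \<Longrightarrow>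
        split_move L r D (\<lambda>a. - c a) (\<lambda>a. - c' a)"
proof -
  obtain x S where S: "S \<subseteq> {a \<in> L. c a = x}" "card S = 2 * r"
    and c': "c' = (\<lambda>a. if a \<in> S then (if card {b \<in> S. b < a} < r then x - 1 else x + 1) else c a)"
    using move unfolding fire_move_def by blast
  define A where "A = {a \<in> S. card {b \<in> S. b < a} < r}"
  define B where "B = S - A"
  have finS: "finite S"
    using S(1) L by (auto intro: finite_subset)
  have SAB: "A \<union> B = S" "A \<inter> B = {}"
    by (auto simp: A_def B_def)
  have cA: "card A = r"
    unfolding A_def using S by (intro card_rank_less finS) auto
  have cB: "card B = r"
    unfolding B_def using S cA finS by (subst card_Diff_subset) (auto simp: A_def)
  have AB: "a < b" if "a \<in> A" "b \<in> B" for a b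
    using that rank_mono[OF finS, of b a] unfolding A_def B_def by fastforce
  have "c' = (\<lambda>a. if a \<in> A then x - 1 else if a \<in> B then x + 1 else c a)"
    by (auto simp: c' A_def B_def)
  moreover have "A \<inter> U \<noteq> {} \<longrightarrow> B \<subseteq> U"
    if "\<And>a b. a \<in> U \<Longrightarrow> b \<in> L \<Longrightarrow> a < b \<Longrightarrow> b \<in> U"
    using that AB S SAB by blast
  ultimately show "split_move L r U c c'"
    if "\<And>a b. a \<in> U \<Longrightarrow> b \<in> L \<Longrightarrow> a < b \<Longrightarrow> b \<in> U"
    unfolding split_move_def using that S SAB cA cB by blast
  have "(\<lambda>a. - c' a) = (\<lambda>a. if a \<in> B then - x - 1 else if a \<in> A then - x + 1 else - c a)"
    by (auto simp: c' A_def B_def)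
  moreover have "B \<inter> D \<noteq> {} \<longrightarrow> A \<subseteq> D"
    if "\<And>a b. a \<in> D \<Longrightarrow> b \<in> L \<Longrightarrow> b < a \<Longrightarrow> b \<in> D"
    using that AB S SAB by blast
  moreover have "B \<union> A \<subseteq> {a \<in> L. - c a = - x}" "B \<inter> A = {}"
    using S SAB by auto
  ultimately show "split_move L r D (\<lambda>a. - c a) (\<lambda>a. - c' a)"
    if "\<And>a b. a \<in> D \<Longrightarrow> b \<in> L \<Longrightarrow> b < a \<Longrightarrow> b \<in> D"
    unfolding split_move_def using that cA cB by blast
qed

section \<open>Chip counts on sites, and sortedness of the terminal configuration\<close>

lemma card_sites:
  assumes "finite L" "finite I" "\<And>i. i \<in> I \<Longrightarrow> card {a \<in> L. c a = i} = r"
  shows "card {a \<in> L. c a \<in> I} = card I * r"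
proof -
  have "{a \<in> L. c a \<in> I} = (\<Union>i\<in>I. {a \<in> L. c a = i})"
    by auto
  then show ?thesis
    using assms by (simp add: card_UN_disjoint disjoint_iff)
qed

theorem theorem3p2:
  fixes L :: "'a::linorder set" and r m :: nat and c :: "'a \<Rightarrow> int"
  assumes "r \<ge> 1" and "m \<ge> 1"
    and "finite L" and "card L = 2 * r * m"
    and "(fire_move L r)\<^sup>*\<^sup>* (\<lambda>_. 0) c"
    and "terminal_config L r c"
  shows "\<forall>a \<in> L. \<forall>b \<in> L. a < b \<longrightarrow> c a \<le> c b"
proof (intro ballI impI)
  fix a b assume ab: "a \<in> L" "b \<in> L" "a < b"
  have cL: "int (card L) = 2 * int r * int m"
    using assms(4) by simp
  have up: "(split_move L r U)\<^sup>*\<^sup>* (\<lambda>_. 0) c"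
    if "\<And>a b. a \<in> U \<Longrightarrow> b \<in> L \<Longrightarrow> a < b \<Longrightarrow> b \<in> U" for U
    using assms(5)
  proof (induction rule: rtranclp_induct)
    case (step y z)
    have "split_move L r U y z"
      by (rule fire_move_split_up[OF assms(3,1) step(2)]) (use that in blast)
    with step(3) show ?case
      by simp
  qed simp
  have down: "(split_move L r D)\<^sup>*\<^sup>* (\<lambda>_. 0) (\<lambda>a. - c a)"
    if "\<And>a b. a \<in> D \<Longrightarrow> b \<in> L \<Longrightarrow> b < a \<Longrightarrow> b \<in> D" for D
    using assms(5)
  proof (induction rule: rtranclp_induct)
    case (step y z)
    have "split_move L r D (\<lambda>a. - y a) (\<lambda>a. - z a)"
      by (rule fire_move_split_down[OF assms(3,1) step(2)]) (use that in blast)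
    with step(3) show ?case
      by simp
  qed simp
  have terminal': "terminal_config L r (\<lambda>a. - c a)"
    using assms(6) by (simp add: terminal_config_def minus_equation_iff[of "c _"] eq_commute[of _ "c _"])
  \<comment> \<open>The count concerns all chips, so the trivial choice \<open>U = {}\<close> with
    \<open>j = 0\<close> serves.\<close>
  have site: "card {a \<in> L. c a = i} = r" if "1 \<le> \<bar>i\<bar>" "\<bar>i\<bar> \<le> int m" for i
    using split_terminal_count[OF assms(3,1) cL _ _ _ up assms(6) that, of "{}" 0] by simp
  have pos: "card {a \<in> L. c a \<in> {p..int m}} = nat (int m - p + 1) * r" if "1 \<le> p" for p
    using card_sites[of L "{p..int m}" c r] site that assms(3) by simp
  have neg: "card {a \<in> L. c a \<in> {- int m..p}} = nat (int m + p + 1) * r" if "p \<le> - 1" for p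
    using card_sites[of L "{- int m..p}" c r] site that assms(3) by (simp add: add.commute)
  \<comment> \<open>These sites account for all \<open>2 * r * m\<close> chips, so the origin is
    empty and no chip is further out than \<open>m\<close>.\<close>
  have "card ({a \<in> L. c a \<in> {- int m..- 1}} \<union> {a \<in> L. c a \<in> {1..int m}}) = card L"
    using pos[of 1] neg[of "- 1"] assms(3,4)
    by (subst card_Un_disjoint) auto
  then have sites: "{a \<in> L. c a \<in> {- int m..- 1}} \<union> {a \<in> L. c a \<in> {1..int m}} = L"
    using assms(3) by (intro card_subset_eq) auto
  then have range: "- int m \<le> c a" "c a \<le> int m" if "a \<in> L" for a
  proof -
    have "a \<in> {a \<in> L. c a \<in> {- int m..- 1}} \<union> {a \<in> L. c a \<in> {1..int m}}"
      using that by (simp only: sites)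
    then show "- int m \<le> c a" "c a \<le> int m"
      by auto
  qed
  show "c a \<le> c b"
  proof (rule ccontr)
    assume "\<not> c a \<le> c b"
    then consider "1 \<le> c a" "c b < c a" | "c b \<le> - 1" "c b < c a" by linarith
    then show False
    proof cases
      case 1
      \<comment> \<open>The number of sites from \<open>c a\<close> to \<open>m\<close>, so that
        \<open>m - j + 1 = c a\<close>. Below, \<open>U\<close> consists of the \<open>r * j\<close>
        largest labels.\<close>
      define j where "j = nat (int m - c a + 1)"
      have j: "int j = int m - c a + 1" "j \<le> m"
        using 1 range[OF ab(1)] by (auto simp: j_def)
      define U where "U = L - {x \<in> L. card {y \<in> L. y < x} < (2 * m - j) * r}"
      have le: "(2 * m - j) * r \<le> card L" "card L - (2 * m - j) * r = j * r"
        using assms(4) j by (auto simp: algebra_simps simp flip: diff_mult_distrib)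
      have cU: "card U = j * r"
        unfolding U_def using assms(3) le
        by (subst card_Diff_subset) (auto simp: card_rank_less)
      have upU: "y \<in> U" if "x \<in> U" "y \<in> L" "x < y" for x y
        using that rank_mono[OF assms(3) less_imp_le, of x y] by (auto simp: U_def)
      have "c a \<le> c x" if "x \<in> U" for x
        using split_terminal_ge[OF assms(3,1) cL _ _ _ up[OF upU] assms(6) _ that, of "int j"]
          cU j by (auto simp: U_def)
      then have "U \<subseteq> {x \<in> L. c x \<in> {c a..int m}}"
        using range by (auto simp: U_def)
      \<comment> \<open>Those sites hold exactly \<open>r * j\<close> chips, so \<open>U\<close>
        fills them; being upward closed, it also contains \<open>b\<close>.\<close>
      then have U_eq: "U = {x \<in> L. c x \<in> {c a..int m}}"
        using assms(3) cU pos[OF 1(1)] by (intro card_subset_eq) (auto simp: j_def)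
      then have "b \<in> U"
        using upU[of a b] ab range by auto
      then show False
        using U_eq 1 by auto
    next
      case 2
      \<comment> \<open>Mirror image in the negated configuration: \<open>j\<close> counts the sites
        from \<open>- m\<close> to \<open>c b\<close>, and \<open>D\<close> consists of the
        \<open>r * j\<close> smallest labels.\<close>
      define j where "j = nat (int m + c b + 1)"
      have j: "int j = int m + c b + 1" "j \<le> m"
        using 2 range[OF ab(2)] by (auto simp: j_def)
      define D where "D = {x \<in> L. card {y \<in> L. y < x} < j * r}"
      have cD: "card D = j * r"
        unfolding D_def using assms(3,4) j by (intro card_rank_less) auto
      have downD: "y \<in> D" if "x \<in> D" "y \<in> L" "y < x" for x y
        using that rank_mono[OF assms(3) less_imp_le, of y x] by (auto simp: D_def)
      have "c x \<le> c b" if "x \<in> D" for x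
        using split_terminal_ge[OF assms(3,1) cL _ _ _ down[OF downD] terminal' _ that, of "int j"]
          cD j by (auto simp: D_def)
      then have "D \<subseteq> {x \<in> L. c x \<in> {- int m..c b}}"
        using range by (auto simp: D_def)
      then have D_eq: "D = {x \<in> L. c x \<in> {- int m..c b}}"
        using assms(3) cD neg[OF 2(1)] by (intro card_subset_eq) (auto simp: j_def)
      then have "a \<in> D"
        using downD[of b a] ab range by auto
      then show False
        using D_eq 2 by auto
    qed
  qed
qed

end
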